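(* If $X|\gamma\sim BeIWei(a,b,\gamma,\theta)$ and $\gamma\sim Ga(\beta)$, then $X$ is distributed as a mixture of the Dagum distributions $Dag(\beta,\lambda_j,\theta)$, with $\lambda_j=a+j$.
   Context: The parameters $a,b,\beta,\theta$ are positive, and $j$ ranges over $0,1,2,\dots$. $X|\gamma\sim\cdots$ denotes the conditional distribution of the random variable $X$ given the random variable $\gamma$. $\Gamma$ is the Gamma function and $B(a,b)=\Gamma(a)\Gamma(b)/\Gamma(a+b)$ the Beta function. $Ga(\beta)$ is the distribution on $(0,\infty)$ with density $\gamma^{\beta-1}e^{-\gamma}/\Gamma(\beta)$. $BeIWei(a,b,\gamma,\theta)$ (Beta-Inverse Weibull) is the distribution on $(0,\infty)$ with density $$\frac{\gamma\theta}{B(a,b)}x^{-\theta-1}e^{-\gamma x^{-\theta}}\left[e^{-\gamma x^{-\theta}}\right]^{a-1}\left[1-e^{-\gamma x^{-\theta}}\right]^{b-1}.$$ $Dag(\beta,\lambda,\theta)$ (Dagum) is the distribution on $(0,\infty)$ with density $\beta\lambda\theta x^{-\theta-1}\left[1+\lambda x^{-\theta}\right]^{-\beta-1}$. A density $p_1(x)$ is said to have a mixture representation if it can be written as $p_1(x)=\int_\Theta p_2(x|\vartheta)p_3(\vartheta)\,d\vartheta$, where $\vartheta$ is regarded as a random variable with density $p_3$ (the mixing density) and $p_2(x|\vartheta)$ is the conditional density of $X$ given $\vartheta$; here the mixture is over the discrete index $j$, so the integral is a sum over $j$.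
   Formalization: For b > 1 the mixture of Dagum distributions has weights summing to one that may be negative, since no mixture with nonnegative weights exists there (e.g. b = 2 gives weights a+1 and −a); for b ≤ 1 it is a genuine mixture. *)

theory Defs
  imports "HOL-Probability.Probability"
begin

text \<open>All densities are taken with respect to Lebesgue measure on the whole real line and
  vanish outside the open half-line of positive reals.\<close>

definition gamma_dist_density :: "real \<Rightarrow> real \<Rightarrow> real" where
  "gamma_dist_density \<beta> g =
     (if g > 0 then g powr (\<beta> - 1) * exp (- g) / Gamma \<beta> else 0)"

definition beiwei_density :: "real \<Rightarrow> real \<Rightarrow> real \<Rightarrow> real \<Rightarrow> real \<Rightarrow> real" where
  "beiwei_density a b \<gamma> \<theta> x =
     (if x > 0 then
        \<gamma> * \<theta> / Beta a b * x powr (- \<theta> - 1) * exp (- \<gamma> * x powr (- \<theta>))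
          * exp (- \<gamma> * x powr (- \<theta>)) powr (a - 1)
          * (1 - exp (- \<gamma> * x powr (- \<theta>))) powr (b - 1)
      else 0)"

definition dagum_density :: "real \<Rightarrow> real \<Rightarrow> real \<Rightarrow> real \<Rightarrow> real" where
  "dagum_density \<beta> l \<theta> x =
     (if x > 0 then
        \<beta> * l * \<theta> * x powr (- \<theta> - 1) * (1 + l * x powr (- \<theta>)) powr (- \<beta> - 1)
      else 0)"

text \<open>\<open>has_cond_density M X G p\<close>: the conditional distribution of \<open>X\<close> given \<open>G\<close> has density
  \<open>p (G \<omega>)\<close>, that is, the conditional probability of \<open>X \<in> A\<close> given the sigma-algebra
  generated by \<open>G\<close> is almost surely the integral of \<open>p (G \<omega>)\<close> over \<open>A\<close>, for every Borel
  set \<open>A\<close>. Values \<open>p g\<close> for \<open>g\<close> outside the almost sure range of \<open>G\<close> are irrelevant.\<close>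

definition has_cond_density ::
    "'a measure \<Rightarrow> ('a \<Rightarrow> real) \<Rightarrow> ('a \<Rightarrow> real) \<Rightarrow> (real \<Rightarrow> real \<Rightarrow> real) \<Rightarrow> bool" where
  "has_cond_density M X G p \<longleftrightarrow>
     X \<in> borel_measurable M \<and> G \<in> borel_measurable M \<and>
     (\<forall>A\<in>sets borel.
        AE \<omega> in M.
          nn_cond_exp M (vimage_algebra (space M) G borel)
              (indicator (X -` A \<inter> space M)) \<omega> =
          (\<integral>\<^sup>+ x \<in> A. ennreal (p (G \<omega>) x) \<partial>lborel))"

text \<open>\<open>generalized_mixture f p w\<close>: the density \<open>f\<close> is the mixture of the densities
  \<open>p 0, p 1, \<dots>\<close> with mixing weights \<open>w\<close>. The weights have total mass one but need not be
  nonnegative; a mixture in the narrow sense, with \<open>w\<close> a probability mass function, is the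
  case where in addition \<open>\<forall>j. 0 \<le> w j\<close>.\<close>

definition generalized_mixture ::
    "(real \<Rightarrow> real) \<Rightarrow> (nat \<Rightarrow> real \<Rightarrow> real) \<Rightarrow> (nat \<Rightarrow> real) \<Rightarrow> bool" where
  "generalized_mixture f p w \<longleftrightarrow>
     summable (\<lambda>j. \<bar>w j\<bar>) \<and> w sums 1 \<and>
     (\<forall>x. 0 \<le> f x \<and> (\<lambda>j. w j * p j x) sums f x)"

end

theory Submission
  imports Defs
begin

text \<open>Given \<open>\<gamma>\<close>, expand \<open>(1 - u) powr (b - 1)\<close> with \<open>u = exp (- \<gamma> * x powr (- \<theta>))\<close> as a binomial
  series in \<open>u\<close>. Integrating the \<open>j\<close>-th term against the gamma density gives a gamma integral, which
  is a multiple of the Dagum density with parameter \<open>a + j\<close>. The resulting weights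
  \<open>w j = (-1) ^ j * (b - 1 gchoose j) / ((a + j) * Beta a b)\<close> are \<open>O(j powr (- b - 1))\<close>,
  which justifies all interchanges, and they add up to one by the same expansion of the Beta
  integral. For \<open>b \<le> 1\<close> they are nonnegative, as
  \<open>(-1) ^ j * (b - 1 gchoose j) = pochhammer (1 - b) j / fact j\<close>.\<close>

section \<open>Real binomial coefficients: sign, growth and termwise integration\<close>

lemma gbinomial_alternating_nonneg:
  fixes z :: real
  assumes "z \<le> 0"
  shows "0 \<le> (-1) ^ n * (z gchoose n)"
proof -
  have "(-1) ^ n * (z gchoose n) = pochhammer (- z) n / fact n"
    by (simp add: gbinomial_pochhammer flip: power_mult_distrib)
  then show ?thesis
    using assms by (simp add: pochhammer_prod prod_nonneg)
qed

text \<open>The coefficients are \<open>O(n powr (- b))\<close>, so the linear denominator brings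
  the terms down to \<open>O(n powr (- b - 1))\<close>, and this exponent lies below
  \<open>- 1\<close> because \<open>b > 0\<close>. Only boundedness is drawn from the asymptotics,
  since the limit \<open>inverse (Gamma (1 - b))\<close> is 0 when \<open>b\<close> is a positive
  integer.\<close>

lemma summable_gbinomial_over_linear:
  fixes a b :: real
  assumes "a > 0" and "b > 0"
  shows "summable (\<lambda>n. \<bar>b - 1 gchoose n\<bar> / (a + real n))"
proof -
  have "(\<lambda>n. (b - 1 gchoose n) / ((-1) ^ n / exp (b * ln (real n)))) \<longlonglongrightarrow> inverse (Gamma (1 - b))"
    using gbinomial_asymptotic[of "b - 1"] by simp
  then have "Bseq (\<lambda>n. (b - 1 gchoose n) / ((-1) ^ n / exp (b * ln (real n))))"
    by (meson Bseq_conv_Bfun convergentI convergent_imp_Bseq)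
  then obtain K where K: "\<And>n. norm ((b - 1 gchoose n) / ((-1) ^ n / exp (b * ln (real n)))) \<le> K"
    by (meson BseqE)
  show ?thesis
  proof (rule summable_comparison_test_ev)
    show "summable (\<lambda>n. K * real n powr (- b - 1))"
      using assms by (intro summable_mult) (simp add: summable_real_powr_iff)
    show "\<forall>\<^sub>F n in sequentially. norm (\<bar>b - 1 gchoose n\<bar> / (a + real n)) \<le> K * real n powr (- b - 1)"
      using eventually_gt_at_top[of 0]
    proof eventually_elim
      case (elim n)
      have "\<bar>b - 1 gchoose n\<bar> * real n powr b \<le> K"
        using K[of n] elim by (simp add: abs_mult powr_def)
      then have "\<bar>b - 1 gchoose n\<bar> \<le> K * real n powr (- b)"
        using elim by (simp add: powr_minus field_simps)
      then have "\<bar>b - 1 gchoose n\<bar> / (a + real n) \<le> K * real n powr (- b) / real n"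
        using elim assms by (intro frac_le) auto
      also have "\<dots> = K * real n powr (- b - 1)"
        using elim by (simp add: powr_diff)
      finally show ?case
        using assms by simp
    qed
  qed
qed

text \<open>Sum and integral may be exchanged because the integrals of the absolute values of the
  terms are summable. Tying the range of \<open>u\<close> to the support of \<open>h\<close> lets
  one statement serve both for \<open>u t = t\<close> on the unit interval and for
  \<open>u g = exp (- (y * g))\<close> on the positive half-line.\<close>

lemma has_bochner_integral_gbinomial_series:
  fixes h u :: "'a \<Rightarrow> real"
  assumes [measurable]: "u \<in> borel_measurable N"
    and nonneg: "\<And>x. 0 \<le> h x" "\<And>x. h x \<noteq> 0 \<Longrightarrow> 0 \<le> u x \<and> u x < 1"
    and m: "\<And>j. has_bochner_integral N (\<lambda>x. h x * u x ^ j) (m j)"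
    and summable: "summable (\<lambda>j. \<bar>z gchoose j\<bar> * m j)"
  shows "has_bochner_integral N (\<lambda>x. h x * (1 - u x) powr z) (\<Sum>j. (-1) ^ j * (z gchoose j) * m j)"
proof -
  define t where "t = (\<lambda>j x. (-1) ^ j * (z gchoose j) * (h x * u x ^ j))"
  have t_int: "has_bochner_integral N (t j) ((-1) ^ j * (z gchoose j) * m j)" for j
    unfolding t_def by (rule has_bochner_integral_mult_right[OF m])
  have norm_t: "norm (t j x) = \<bar>z gchoose j\<bar> * (h x * u x ^ j)" for j x
    using nonneg[of x] by (cases "h x = 0") (auto simp: t_def abs_mult)
  have series: "(\<lambda>j. t j x) sums (h x * (1 - u x) powr z)" "summable (\<lambda>j. norm (t j x))" for x
  proof -
    have "(\<lambda>j. t j x) sums (h x * (1 - u x) powr z) \<and> summable (\<lambda>j. norm (t j x))"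
    proof (cases "h x = 0")
      case True
      then show ?thesis by (simp add: t_def)
    next
      case False
      then have u: "0 \<le> u x" "u x < 1" using nonneg by auto
      have "(\<lambda>j. (z gchoose j) * (- u x) ^ j) sums (1 + - u x) powr z"
        by (rule gen_binomial_real) (use u in simp)
      from sums_mult[OF this, of "h x"] have 1: "(\<lambda>j. t j x) sums (h x * (1 - u x) powr z)"
        by (simp add: t_def power_minus[of "u x"] mult_ac)
      \<comment> \<open>Convergence of the series at a point \<open>r\<close> strictly beyond
        \<open>u x\<close> gives absolute convergence at \<open>u x\<close>.\<close>
      obtain r where r: "u x < r" "r < 1" using u dense by blast
      have "summable (\<lambda>j. norm ((z gchoose j) * u x ^ j))"
        by (rule powser_insidea[where x = r])
           (use r u gen_binomial_real[of r z] in \<open>auto simp: sums_iff\<close>)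
      from summable_mult[OF this, of "h x"] have "summable (\<lambda>j. norm (t j x))"
        using u unfolding norm_t by (simp add: abs_mult mult_ac)
      with 1 show ?thesis by blast
    qed
    then show "(\<lambda>j. t j x) sums (h x * (1 - u x) powr z)" "summable (\<lambda>j. norm (t j x))"
      by auto
  qed
  have int: "integrable N (t j)" for j
    using t_int by (auto simp: has_bochner_integral_iff)
  have "(\<integral>x. norm (t j x) \<partial>N) = \<bar>z gchoose j\<bar> * m j" for j
    unfolding norm_t using has_bochner_integral_mult_right[OF m] by (simp add: has_bochner_integral_iff)
  then have norm_summable: "summable (\<lambda>j. \<integral>x. norm (t j x) \<partial>N)"
    using summable by simp
  have eq: "(\<Sum>j. t j x) = h x * (1 - u x) powr z" for x
    using series(1)[of x] by (simp add: sums_iff)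
  have "has_bochner_integral N (\<lambda>x. \<Sum>j. t j x) (\<Sum>j. integral\<^sup>L N (t j))"
    unfolding has_bochner_integral_iff
    using integrable_suminf[OF int _ norm_summable] integral_suminf[OF int _ norm_summable] series(2)
    by simp
  moreover have "integral\<^sup>L N (t j) = (-1) ^ j * (z gchoose j) * m j" for j
    using t_int by (simp add: has_bochner_integral_iff)
  ultimately show ?thesis
    by (simp add: eq)
qed

section \<open>Power, Beta and Gamma integrals\<close>

lemma has_bochner_integral_powr_01:
  fixes s :: real
  assumes "s > 0"
  shows "has_bochner_integral lborel (\<lambda>t. indicator {0<..<1} t * t powr (s - 1)) (1 / s)"
proof (rule has_bochner_integral_nn_integral)
  have "((\<lambda>t. t powr (s - 1)) has_integral (1 powr (s - 1 + 1) / (s - 1 + 1))) {0..1}"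
    using assms by (intro has_integral_powr_from_0) auto
  then have "((\<lambda>t. t powr (s - 1)) has_integral (1 / s)) {0<..<1}"
    by (simp add: has_integral_Icc_iff_Ioo)
  from nn_integral_has_integral_lebesgue[OF _ this]
  show "(\<integral>\<^sup>+t. ennreal (indicator {0<..<1} t * t powr (s - 1)) \<partial>lborel) = ennreal (1 / s)"
    by simp
qed (use assms in auto)

lemma has_bochner_integral_Beta:
  fixes a b :: real
  assumes "a > 0" and "b > 0"
  shows "has_bochner_integral lborel
    (\<lambda>t. indicator {0<..<1} t * t powr (a - 1) * (1 - t) powr (b - 1)) (Beta a b)"
proof (rule has_bochner_integral_nn_integral)
  have "((\<lambda>t. t powr (a - 1) * (1 - t) powr (b - 1)) has_integral Beta a b) {0<..<1}"
    using has_integral_Beta_real[OF assms] by (simp add: has_integral_Icc_iff_Ioo)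
  from nn_integral_has_integral_lebesgue[OF _ this]
  show "(\<integral>\<^sup>+t. ennreal (indicator {0<..<1} t * t powr (a - 1) * (1 - t) powr (b - 1)) \<partial>lborel)
      = ennreal (Beta a b)"
    by (simp add: mult.assoc)
  show "0 \<le> Beta a b"
    using assms by (simp add: Beta_def Gamma_real_nonneg)
qed auto

text \<open>Substitution of \<open>c * t\<close> for \<open>t\<close> in the Gamma integral: the
  Jacobian accounts for one power of \<open>c\<close>, and \<open>(c * t) powr (s - 1)\<close> for
  the remaining \<open>s - 1\<close>.\<close>

lemma has_bochner_integral_Gamma_scaled:
  fixes s c :: real
  assumes "s > 0" and "c > 0"
  shows "has_bochner_integral lborel (\<lambda>t. indicator {0<..} t * (t powr (s - 1) * exp (- (c * t))))
    (Gamma s / c powr s)"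
proof -
  have "has_bochner_integral lborel (\<lambda>t. indicator {0..} t * t powr (s - 1) / exp t) (Gamma s)"
    by (rule has_bochner_integral_nn_integral)
       (use assms Gamma_conv_nn_integral_real[of s] in \<open>auto simp: Gamma_real_nonneg\<close>)
  then have "has_bochner_integral lborel
      (\<lambda>t. indicator {0..} (c * t) * (c * t) powr (s - 1) / exp (c * t)) (Gamma s / c)"
    using lborel_has_bochner_integral_real_affine_iff[of c _ "Gamma s" 0] assms
    by (simp add: divide_inverse mult.commute)
  from has_bochner_integral_mult_right[OF this, of "c powr (1 - s)"]
  have "has_bochner_integral lborel
      (\<lambda>t. c powr (1 - s) * (indicator {0..} (c * t) * (c * t) powr (s - 1) / exp (c * t)))
      (c powr (1 - s) * (Gamma s / c))" by simp
  moreover have "c powr (1 - s) * (indicator {0..} (c * t) * (c * t) powr (s - 1) / exp (c * t))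
      = indicator {0<..} t * (t powr (s - 1) * exp (- (c * t)))" for t
  proof (cases "t > 0")
    case True
    have "c powr (1 - s) * c powr (s - 1) = 1"
      using assms by (simp flip: powr_add)
    then show ?thesis
      using True assms by (simp add: powr_mult exp_minus divide_inverse mult_ac)
  next
    case False
    \<comment> \<open>At \<open>t = 0\<close> the closed and the open half-line still give the same
      value, because \<open>0 powr (s - 1) = 0\<close>.\<close>
    then have "t = 0 \<or> c * t < 0" using assms by (auto simp: mult_less_0_iff)
    then show ?thesis using False by auto
  qed
  moreover have "c powr (1 - s) * (Gamma s / c) = Gamma s / c powr s"
    using assms by (simp add: powr_diff)
  ultimately show ?thesis by simp
qed

section \<open>The mixing weights\<close>

definition dagum_weight :: "real \<Rightarrow> real \<Rightarrow> nat \<Rightarrow> real" where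
  "dagum_weight a b j = (-1) ^ j * (b - 1 gchoose j) / ((a + real j) * Beta a b)"

lemma Beta_real_pos:
  fixes a b :: real
  shows "a > 0 \<Longrightarrow> b > 0 \<Longrightarrow> Beta a b > 0"
  by (simp add: Beta_def Gamma_real_pos)

lemma dagum_weight_nonneg:
  assumes "a > 0" and "b > 0" and "b \<le> 1"
  shows "0 \<le> dagum_weight a b j"
  unfolding dagum_weight_def using assms Beta_real_pos[of a b]
  by (intro divide_nonneg_nonneg gbinomial_alternating_nonneg) auto

lemma summable_abs_dagum_weight:
  assumes "a > 0" and "b > 0"
  shows "summable (\<lambda>j. \<bar>dagum_weight a b j\<bar>)"
proof -
  have "\<bar>dagum_weight a b j\<bar> = \<bar>b - 1 gchoose j\<bar> / (a + real j) / Beta a b" for j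
    using assms Beta_real_pos[OF assms] by (simp add: dagum_weight_def abs_mult)
  then show ?thesis
    using summable_divide[OF summable_gbinomial_over_linear[OF assms]] by simp
qed

text \<open>Termwise integration with \<open>u t = t\<close> expands the Beta integrand. The moments
  are \<open>1 / (a + real j)\<close>, so the resulting series is \<open>Beta a b\<close> times the
  sum of the weights, while its value is \<open>Beta a b\<close>.\<close>

lemma dagum_weight_sums_1:
  assumes "a > 0" and "b > 0"
  shows "dagum_weight a b sums 1"
proof -
  let ?h = "\<lambda>t::real. indicator {0<..<1} t * t powr (a - 1)"
  have "has_bochner_integral lborel (\<lambda>t. ?h t * t ^ j) (1 / (a + real j))" for j
  proof -
    have eq: "?h t * t ^ j = indicator {0<..<1} t * t powr (a + real j - 1)" for t :: real
      by (auto simp: indicator_def powr_add powr_diff powr_realpow)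
    then show ?thesis
      unfolding eq using has_bochner_integral_powr_01[of "a + real j"] assms by simp
  qed
  moreover have "summable (\<lambda>j. \<bar>b - 1 gchoose j\<bar> * (1 / (a + real j)))"
    using summable_gbinomial_over_linear[OF assms] by simp
  ultimately have "has_bochner_integral lborel (\<lambda>t. ?h t * (1 - t) powr (b - 1))
      (\<Sum>j. (-1) ^ j * (b - 1 gchoose j) * (1 / (a + real j)))"
    by (intro has_bochner_integral_gbinomial_series) (auto simp: indicator_def split: if_splits)
  then have "(\<Sum>j. (-1) ^ j * (b - 1 gchoose j) * (1 / (a + real j))) = Beta a b"
    using has_bochner_integral_Beta[OF assms] has_bochner_integral_eq by blast
  moreover have "(-1) ^ j * (b - 1 gchoose j) * (1 / (a + real j)) = Beta a b * dagum_weight a b j" for j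
    using Beta_real_pos[OF assms] by (simp add: dagum_weight_def)
  moreover have s: "summable (dagum_weight a b)"
    using summable_abs_dagum_weight[OF assms] summable_rabs_cancel by blast
  ultimately have "Beta a b * suminf (dagum_weight a b) = Beta a b"
    by (simp add: suminf_mult)
  then show ?thesis
    using s Beta_real_pos[OF assms] by (simp add: sums_iff)
qed

section \<open>Averaging the conditional density over the gamma distribution\<close>

lemma summable_dagum_mixture:
  assumes "a > 0" and "b > 0" and "\<beta> > 0" and "\<theta> > 0"
  shows "summable (\<lambda>j. \<bar>dagum_weight a b j\<bar> * dagum_density \<beta> (a + real j) \<theta> x)"
\<comment> \<open>The bound \<open>\<beta> * \<theta> / \<bar>x\<bar>\<close> on the Dagum density
  does not depend on \<open>j\<close>, so absolute summability of the weights suffices.\<close>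
proof (rule summable_comparison_test)
  show "summable (\<lambda>j. \<bar>dagum_weight a b j\<bar> * (\<beta> * \<theta> / \<bar>x\<bar>))"
    by (intro summable_mult2 summable_abs_dagum_weight assms)
  have "\<bar>dagum_density \<beta> l \<theta> x\<bar> \<le> \<beta> * \<theta> / \<bar>x\<bar>" if "l > 0" for l
  proof (cases "x > 0")
    case True
    \<comment> \<open>Up to the factor \<open>\<beta> * \<theta> / x\<close>, the density depends on
      \<open>l\<close> only through \<open>z\<close>, and \<open>z / (1 + z) \<le> 1\<close> bounds
      it.\<close>
    define z where "z = l * x powr (- \<theta>)"
    have z: "z > 0" using that True by (simp add: z_def)
    have "(1 + z) powr (- \<beta> - 1) \<le> (1 + z) powr (- 1)"
      using assms z by (intro powr_mono) auto
    then have "z * (1 + z) powr (- \<beta> - 1) \<le> z * (1 + z) powr (- 1)"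
      using z by (intro mult_left_mono) auto
    also have "\<dots> \<le> 1"
      using z by (simp add: powr_minus divide_simps)
    finally have "\<beta> * \<theta> / x * (z * (1 + z) powr (- \<beta> - 1)) \<le> \<beta> * \<theta> / x * 1"
      using assms True by (intro mult_left_mono) auto
    moreover have "dagum_density \<beta> l \<theta> x = \<beta> * \<theta> / x * (z * (1 + z) powr (- \<beta> - 1))"
      using True by (simp add: dagum_density_def z_def powr_diff)
    moreover have "0 \<le> \<beta> * \<theta> / x * (z * (1 + z) powr (- \<beta> - 1))"
      using z assms True by (intro mult_nonneg_nonneg) auto
    ultimately show ?thesis using True by simp
  qed (use assms in \<open>auto simp: dagum_density_def divide_le_0_iff\<close>)
  then have "norm (\<bar>dagum_weight a b j\<bar> * dagum_density \<beta> (a + real j) \<theta> x)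
      \<le> \<bar>dagum_weight a b j\<bar> * (\<beta> * \<theta> / \<bar>x\<bar>)" for j
    unfolding real_norm_def abs_mult abs_idempotent using assms by (intro mult_left_mono) auto
  then show "\<exists>N. \<forall>j\<ge>N. norm (\<bar>dagum_weight a b j\<bar> * dagum_density \<beta> (a + real j) \<theta> x)
      \<le> \<bar>dagum_weight a b j\<bar> * (\<beta> * \<theta> / \<bar>x\<bar>)"
    by blast
qed

text \<open>For \<open>x > 0\<close> the integrand is a constant times
  \<open>?h g * (1 - ?u g) powr (b - 1)\<close>, which the binomial series turns into Gamma
  integrals. For other \<open>x\<close> both sides vanish.\<close>

lemma has_bochner_integral_beiwei_gamma:
  assumes "a > 0" and "b > 0" and "\<beta> > 0" and "\<theta> > 0"
  shows "has_bochner_integral lborel (\<lambda>g. gamma_dist_density \<beta> g * beiwei_density a b g \<theta> x)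
    (\<Sum>j. dagum_weight a b j * dagum_density \<beta> (a + real j) \<theta> x)"
proof (cases "x > 0")
  case True
  define y where "y = x powr (- \<theta>)"
  have y: "y > 0" using True by (simp add: y_def)
  \<comment> \<open>\<open>K\<close> collects every factor free of \<open>g\<close>.\<close>
  define K where "K = \<theta> * x powr (- \<theta> - 1) / (Beta a b * Gamma \<beta>)"
  \<comment> \<open>A Gamma integral with shape \<open>\<beta> + 1\<close>, raised by one through
    the factor \<open>\<gamma>\<close> of the conditional density. In its rate, 1 comes from the
    gamma density, \<open>a * y\<close> from the \<open>a\<close>-th power of \<open>?u g\<close>,
    and \<open>real j * y\<close> from the series.\<close>
  define m where "m j = Gamma (\<beta> + 1) / (1 + (a + real j) * y) powr (\<beta> + 1)" for j
  let ?h = "\<lambda>g::real. indicator {0<..} g * (g powr \<beta> * exp (- ((1 + a * y) * g)))"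
  let ?u = "\<lambda>g::real. exp (- (y * g))"
  have Kpos: "K > 0"
    using assms True Beta_real_pos[of a b] Gamma_real_pos[of \<beta>] by (simp add: K_def)
  \<comment> \<open>\<open>Gamma (\<beta> + 1) = \<beta> * Gamma \<beta>\<close> supplies the factor
    \<open>\<beta>\<close> of the Dagum density; its factor \<open>a + real j\<close> cancels the
    denominator of the weight.\<close>
  have Km: "K * ((-1) ^ j * (b - 1 gchoose j) * m j)
      = dagum_weight a b j * dagum_density \<beta> (a + real j) \<theta> x" for j
  proof -
    have "(1 + (a + real j) * y) powr (- \<beta> - 1) = 1 / (1 + (a + real j) * y) powr (\<beta> + 1)"
      using powr_minus[of "1 + (a + real j) * y" "\<beta> + 1"] by (simp add: divide_inverse)
    moreover have "Gamma (\<beta> + 1) = \<beta> * Gamma \<beta>"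
      using assms by (intro Gamma_plus1) auto
    moreover have "Gamma \<beta> > 0" "Beta a b > 0" "a + real j > 0"
      using assms Gamma_real_pos Beta_real_pos by auto
    ultimately show ?thesis
      using True by (simp add: K_def m_def dagum_weight_def dagum_density_def flip: y_def)
  qed
  have "has_bochner_integral lborel (\<lambda>g. ?h g * ?u g ^ j) (m j)" for j
  proof -
    have eq: "?h g * ?u g ^ j = indicator {0<..} g * (g powr (\<beta> + 1 - 1) * exp (- ((1 + (a + real j) * y) * g)))"
      for g
      by (simp add: algebra_simps flip: exp_of_nat_mult exp_add)
    then show ?thesis
      unfolding eq m_def using has_bochner_integral_Gamma_scaled[of "\<beta> + 1" "1 + (a + real j) * y"] assms y
      by (simp add: add_pos_pos)
  qed
  \<comment> \<open>Taking absolute values in \<open>Km\<close> identifies this series, up to the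
    factor \<open>K > 0\<close>, with the Dagum series already known to be summable.\<close>
  moreover have "summable (\<lambda>j. \<bar>b - 1 gchoose j\<bar> * m j)"
  proof -
    have "m j \<ge> 0" for j
      using assms by (simp add: m_def Gamma_real_nonneg)
    moreover have "dagum_density \<beta> (a + real j) \<theta> x \<ge> 0" for j
      using assms by (simp add: dagum_density_def)
    ultimately have "\<bar>dagum_weight a b j\<bar> * dagum_density \<beta> (a + real j) \<theta> x
        = K * (\<bar>b - 1 gchoose j\<bar> * m j)" for j
      using arg_cong[OF Km[of j], of abs] Kpos by (simp add: abs_mult)
    then have "summable (\<lambda>j. K * (\<bar>b - 1 gchoose j\<bar> * m j))"
      using summable_dagum_mixture[OF assms, of x] by simp
    then show ?thesis
      by (rule summable_mult_D) (use Kpos in simp)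
  qed
  ultimately have "has_bochner_integral lborel (\<lambda>g. ?h g * (1 - ?u g) powr (b - 1))
      (\<Sum>j. (-1) ^ j * (b - 1 gchoose j) * m j)"
    using y by (intro has_bochner_integral_gbinomial_series) (auto simp: indicator_def split: if_splits)
  from has_bochner_integral_mult_right[OF this, of K]
  have "has_bochner_integral lborel (\<lambda>g. K * (?h g * (1 - ?u g) powr (b - 1)))
      (K * (\<Sum>j. (-1) ^ j * (b - 1 gchoose j) * m j))" by simp
  moreover have "K * (\<Sum>j. (-1) ^ j * (b - 1 gchoose j) * m j)
      = (\<Sum>j. dagum_weight a b j * dagum_density \<beta> (a + real j) \<theta> x)"
  proof -
    have "summable (\<lambda>j. \<bar>(-1) ^ j * (b - 1 gchoose j) * m j\<bar>)"
      using \<open>summable (\<lambda>j. \<bar>b - 1 gchoose j\<bar> * m j)\<close> assms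
      by (simp add: abs_mult m_def Gamma_real_nonneg)
    then have "summable (\<lambda>j. (-1) ^ j * (b - 1 gchoose j) * m j)"
      by (rule summable_rabs_cancel)
    from suminf_mult[OF this, of K] show ?thesis
      by (simp add: Km)
  qed
  moreover have "gamma_dist_density \<beta> g * beiwei_density a b g \<theta> x
      = K * (?h g * (1 - ?u g) powr (b - 1))" for g
  proof (cases "g > 0")
    case g: True
    \<comment> \<open>The spare \<open>exp (g * y)\<close> cancels against the separate exponential
      factor of the conditional density, leaving the \<open>a\<close>-th power.\<close>
    have "exp (- (g * y)) powr (a - 1) = exp (- (a * g * y)) * exp (g * y)"
      by (simp add: powr_def algebra_simps flip: exp_add)
    moreover have "g powr (\<beta> - 1) = g powr \<beta> / g"
      using g by (simp add: powr_diff)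
    moreover have "exp (- ((1 + a * y) * g)) = exp (- g) * exp (- (a * g * y))"
      by (simp add: algebra_simps flip: exp_add)
    moreover have "exp (- (g * y)) * exp (g * y) = 1"
      by (simp flip: exp_add)
    ultimately show ?thesis
      using g True
      by (simp add: gamma_dist_density_def beiwei_density_def K_def mult_ac flip: y_def)
  qed (simp add: gamma_dist_density_def)
  ultimately show ?thesis by simp
qed (simp add: beiwei_density_def dagum_density_def has_bochner_integral_zero)

section \<open>From the conditional to the marginal density\<close>

text \<open>By the tower property, the probability of \<open>X\<close> lying in \<open>A\<close> is
  the mean of its conditional probability given \<open>G\<close>. Writing this mean with the density
  \<open>q\<close> and exchanging the integrals by Tonelli yields the marginal density.\<close>

lemma distributed_has_cond_density:
  assumes "prob_space M"
    and cond: "has_cond_density M X G p"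
    and G: "distributed M lborel G q"
    and [measurable]: "(\<lambda>(g, x). ennreal (p g x)) \<in> borel_measurable (borel \<Otimes>\<^sub>M borel)"
  shows "distributed M lborel X (\<lambda>x. \<integral>\<^sup>+g. q g * ennreal (p g x) \<partial>lborel)"
proof -
  interpret prob_space M by fact
  have X[measurable]: "X \<in> borel_measurable M" and [measurable]: "G \<in> borel_measurable M"
    using cond by (auto simp: has_cond_density_def)
  have [measurable]: "q \<in> borel_measurable borel"
    using distributed_borel_measurable[OF G] by simp
  let ?F = "vimage_algebra (space M) G borel"
  interpret finite_measure_subalgebra M ?F
    by standard (auto simp: subalgebra_def sets_vimage_algebra2 intro!: measurable_sets)
  have emeasure_X: "emeasure M (X -` A \<inter> space M) = (\<integral>\<^sup>+x\<in>A. (\<integral>\<^sup>+g. q g * ennreal (p g x) \<partial>lborel) \<partial>lborel)"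
    if [measurable]: "A \<in> sets borel" for A
  proof -
    \<comment> \<open>The factor 1 is the function measurable with respect to \<open>?F\<close>
      against which the defining property of the conditional expectation is tested.\<close>
    have "emeasure M (X -` A \<inter> space M) = (\<integral>\<^sup>+\<omega>. 1 * indicator (X -` A \<inter> space M) \<omega> \<partial>M)"
      by simp
    also have "\<dots> = (\<integral>\<^sup>+\<omega>. 1 * nn_cond_exp M ?F (indicator (X -` A \<inter> space M)) \<omega> \<partial>M)"
      by (rule nn_cond_exp_intg[symmetric]) auto
    \<comment> \<open>The exceptional null set may depend on \<open>A\<close>, which is harmless as
      \<open>A\<close> stays fixed.\<close>
    also have "\<dots> = (\<integral>\<^sup>+\<omega>. (\<integral>\<^sup>+x\<in>A. ennreal (p (G \<omega>) x) \<partial>lborel) \<partial>M)"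
      using cond that by (intro nn_integral_cong_AE) (auto simp: has_cond_density_def)
    also have "\<dots> = (\<integral>\<^sup>+g. q g * (\<integral>\<^sup>+x\<in>A. ennreal (p g x) \<partial>lborel) \<partial>lborel)"
      by (rule distributed_nn_integral[OF G, symmetric]) simp
    also have "\<dots> = (\<integral>\<^sup>+g. (\<integral>\<^sup>+x. q g * (ennreal (p g x) * indicator A x) \<partial>lborel) \<partial>lborel)"
      by (intro nn_integral_cong nn_integral_cmult[symmetric]) simp
    also have "\<dots> = (\<integral>\<^sup>+x. (\<integral>\<^sup>+g. q g * (ennreal (p g x) * indicator A x) \<partial>lborel) \<partial>lborel)"
      by (rule lborel_pair.Fubini') simp
    also have "\<dots> = (\<integral>\<^sup>+x\<in>A. (\<integral>\<^sup>+g. q g * ennreal (p g x) \<partial>lborel) \<partial>lborel)"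
      by (simp add: nn_integral_multc flip: mult.assoc)
    finally show ?thesis .
  qed
  show ?thesis
    unfolding distributed_def
  proof (intro conjI measure_eqI)
    fix A assume "A \<in> sets (distr M lborel X)"
    then have [measurable]: "A \<in> sets borel" by simp
    show "emeasure (distr M lborel X) A
        = emeasure (density lborel (\<lambda>x. \<integral>\<^sup>+g. q g * ennreal (p g x) \<partial>lborel)) A"
      by (simp add: emeasure_distr emeasure_density emeasure_X)
  qed auto
qed

theorem proposition6:
  fixes M :: "'a measure" and X G :: "'a \<Rightarrow> real" and a b \<beta> \<theta> :: real
  assumes "prob_space M"
    and "a > 0" and "b > 0" and "\<beta> > 0" and "\<theta> > 0"
    and "has_cond_density M X G (\<lambda>\<gamma>. beiwei_density a b \<gamma> \<theta>)"
    and "distributed M lborel G (\<lambda>\<gamma>. ennreal (gamma_dist_density \<beta> \<gamma>))"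
  shows "\<exists>f w. distributed M lborel X (\<lambda>x. ennreal (f x)) \<and>
    generalized_mixture f (\<lambda>j. dagum_density \<beta> (a + real j) \<theta>) w \<and>
    (b \<le> 1 \<longrightarrow> (\<forall>j. 0 \<le> w j))"
proof -
  define f where "f x = (\<Sum>j. dagum_weight a b j * dagum_density \<beta> (a + real j) \<theta> x)" for x
  have int: "has_bochner_integral lborel (\<lambda>g. gamma_dist_density \<beta> g * beiwei_density a b g \<theta> x) (f x)" for x
    unfolding f_def using assms by (intro has_bochner_integral_beiwei_gamma)
  \<comment> \<open>The product is treated as a whole: the gamma density vanishes for
    \<open>g \<le> 0\<close>, so the sign of \<open>beiwei_density\<close> there does not
    matter.\<close>
  have nonneg: "0 \<le> gamma_dist_density \<beta> g" "0 \<le> gamma_dist_density \<beta> g * beiwei_density a b g \<theta> x" for g x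
    using assms Gamma_real_pos[of \<beta>] Beta_real_pos[of a b]
    by (auto simp: gamma_dist_density_def beiwei_density_def)
  \<comment> \<open>The series may have negative weights when \<open>b > 1\<close>, so the sign is
    read off the integral instead.\<close>
  have f_nonneg: "0 \<le> f x" for x
    unfolding has_bochner_integral_integral_eq[OF int, symmetric]
    by (intro Bochner_Integration.integral_nonneg nonneg)
  have "(\<integral>\<^sup>+g. ennreal (gamma_dist_density \<beta> g) * ennreal (beiwei_density a b g \<theta> x) \<partial>lborel) = ennreal (f x)" for x
    using int[of x] nonneg by (simp add: has_bochner_integral_iff nn_integral_eq_integral flip: ennreal_mult')
  moreover have "(\<lambda>(g, x). ennreal (beiwei_density a b g \<theta> x)) \<in> borel_measurable (borel \<Otimes>\<^sub>M borel)"
    unfolding beiwei_density_def by measurable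
  ultimately have "distributed M lborel X (\<lambda>x. ennreal (f x))"
    using distributed_has_cond_density[OF assms(1,6,7)] by simp
  \<comment> \<open>Defining \<open>f\<close> by an infinite sum does not by itself give
    convergence; this follows from absolute summability.\<close>
  moreover have "(\<lambda>j. dagum_weight a b j * dagum_density \<beta> (a + real j) \<theta> x) sums f x" for x
  proof -
    have "dagum_density \<beta> (a + real j) \<theta> x \<ge> 0" for j
      using assms by (simp add: dagum_density_def)
    then have "summable (\<lambda>j. \<bar>dagum_weight a b j * dagum_density \<beta> (a + real j) \<theta> x\<bar>)"
      using summable_dagum_mixture[OF assms(2-5), of x] by (simp add: abs_mult)
    then show ?thesis
      unfolding f_def by (intro summable_sums) (rule summable_rabs_cancel)
  qed
  ultimately have "distributed M lborel X (\<lambda>x. ennreal (f x)) \<and>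
    generalized_mixture f (\<lambda>j. dagum_density \<beta> (a + real j) \<theta>) (dagum_weight a b) \<and>
    (b \<le> 1 \<longrightarrow> (\<forall>j. 0 \<le> dagum_weight a b j))"
    using assms f_nonneg dagum_weight_nonneg summable_abs_dagum_weight dagum_weight_sums_1
    by (auto simp: generalized_mixture_def)
  then show ?thesis by blast
qed

end
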